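(* Let $m,n \geq 2$. Then the poset $\mathbb{P} = m \oplus n$ is S\l upecki.
   Context: Posets are viewed as reflexive digraphs with arc relation $\leq$. For $n\geq1$, $n$ also denotes the $n$-element antichain (no comparabilities other than $x\le x$). The ordinal sum $\mathbb{P}\oplus\mathbb{Q}$ is the disjoint union of $\mathbb{P}$ and $\mathbb{Q}$ with additionally $p\leq q$ for all $p\in P$, $q\in Q$. A $k$-ary polymorphism of $\mathbb{P}$ is a monotone map $\mathbb{P}^k\to\mathbb{P}$ (product order); it is essentially unary if it equals $(x_1,\dots,x_k)\mapsto g(x_i)$ for some $i$ and some monotone $g:\mathbb{P}\to\mathbb{P}$. $\mathbb{P}$ is S\l upecki if for every $k\geq 2$ every surjective $k$-ary polymorphism is essentially unary. *)

theory Defs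
  imports Main "HOL-Library.FuncSet"
begin

text \<open>
  A poset is a relation \<open>r\<close> with \<^term>\<open>Partial_order r\<close>; since \<open>r\<close> is reflexive on its field,
  the underlying set is \<^term>\<open>Field r\<close> and \<open>(x, y) \<in> r\<close> means \<open>x \<le> y\<close>.
\<close>

definition antichain :: "nat \<Rightarrow> nat rel" where
  "antichain n = Id_on {..<n}"

definition ordinal_sum :: "'a rel \<Rightarrow> 'b rel \<Rightarrow> ('a + 'b) rel"  (infixr "\<oplus>\<^sub>o" 65) where
  "r \<oplus>\<^sub>o s =
     {(Inl x, Inl y) | x y. (x, y) \<in> r} \<union>
     {(Inr x, Inr y) | x y. (x, y) \<in> s} \<union>
     {(Inl x, Inr y) | x y. x \<in> Field r \<and> y \<in> Field s}"

text \<open>A \<open>k\<close>-tuple is an extensional function on \<open>{..<k}\<close>.\<close>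

definition power_order :: "'a rel \<Rightarrow> nat \<Rightarrow> (nat \<Rightarrow> 'a) rel" where
  "power_order r k =
     {(x, y). x \<in> {..<k} \<rightarrow>\<^sub>E Field r \<and> y \<in> {..<k} \<rightarrow>\<^sub>E Field r \<and> (\<forall>i<k. (x i, y i) \<in> r)}"

definition monotone_map :: "'a rel \<Rightarrow> 'b rel \<Rightarrow> ('a \<Rightarrow> 'b) \<Rightarrow> bool" where
  "monotone_map r s f \<longleftrightarrow>
     f \<in> Field r \<rightarrow> Field s \<and>
     monotone_on (Field r) (\<lambda>x y. (x, y) \<in> r) (\<lambda>x y. (x, y) \<in> s) f"

definition polymorphism :: "'a rel \<Rightarrow> nat \<Rightarrow> ((nat \<Rightarrow> 'a) \<Rightarrow> 'a) \<Rightarrow> bool" where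
  "polymorphism r k f \<longleftrightarrow> monotone_map (power_order r k) r f"

definition essentially_unary :: "'a rel \<Rightarrow> nat \<Rightarrow> ((nat \<Rightarrow> 'a) \<Rightarrow> 'a) \<Rightarrow> bool" where
  "essentially_unary r k f \<longleftrightarrow>
     (\<exists>i<k. \<exists>g. monotone_map r r g \<and> (\<forall>x \<in> Field (power_order r k). f x = g (x i)))"

definition slupecki :: "'a rel \<Rightarrow> bool" where
  "slupecki r \<longleftrightarrow>
     (\<forall>k\<ge>2. \<forall>f. polymorphism r k f \<and> f ` Field (power_order r k) = Field r
        \<longrightarrow> essentially_unary r k f)"

lemma Field_antichain [simp]: "Field (antichain n) = {..<n}"
  by (auto simp: antichain_def Field_def)

lemma Partial_order_antichain: "Partial_order (antichain n)"
  by (auto simp: antichain_def partial_order_on_def preorder_on_def refl_on_def trans_def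
      antisym_def Field_def)

lemma mem_ordinal_sum:
  "(Inl x, Inl x') \<in> r \<oplus>\<^sub>o s \<longleftrightarrow> (x, x') \<in> r"
  "(Inr y, Inr y') \<in> r \<oplus>\<^sub>o s \<longleftrightarrow> (y, y') \<in> s"
  "(Inl x, Inr y) \<in> r \<oplus>\<^sub>o s \<longleftrightarrow> x \<in> Field r \<and> y \<in> Field s"
  "(Inr y, Inl x) \<notin> r \<oplus>\<^sub>o s"
  by (auto simp: ordinal_sum_def)

lemma Field_ordinal_sum:
  "Field (r \<oplus>\<^sub>o s) = Inl ` Field r \<union> Inr ` Field s"
proof (rule set_eqI)
  fix z
  show "z \<in> Field (r \<oplus>\<^sub>o s) \<longleftrightarrow> z \<in> Inl ` Field r \<union> Inr ` Field s"
    by (cases z) (auto simp: ordinal_sum_def Field_def Domain_iff Range_iff)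
qed

lemma Partial_order_ordinal_sum:
  assumes "Partial_order r" "Partial_order s"
  shows "Partial_order (r \<oplus>\<^sub>o s)"
proof -
  have r: "\<And>x. x \<in> Field r \<Longrightarrow> (x, x) \<in> r" "trans r" "antisym r"
    and s: "\<And>x. x \<in> Field s \<Longrightarrow> (x, x) \<in> s" "trans s" "antisym s"
    using assms by (auto simp: partial_order_on_def preorder_on_def refl_on_def)
  have "refl_on (Field (r \<oplus>\<^sub>o s)) (r \<oplus>\<^sub>o s)"
    unfolding refl_on_def Field_ordinal_sum using r(1) s(1) by (auto simp: ordinal_sum_def)
  moreover have "trans (r \<oplus>\<^sub>o s)"
  proof (rule transI)
    fix x y z assume "(x, y) \<in> r \<oplus>\<^sub>o s" "(y, z) \<in> r \<oplus>\<^sub>o s"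
    then show "(x, z) \<in> r \<oplus>\<^sub>o s"
      by (cases x; cases y; cases z)
        (auto simp: mem_ordinal_sum dest: transD[OF r(2)] transD[OF s(2)] intro: FieldI1 FieldI2)
  qed
  moreover have "antisym (r \<oplus>\<^sub>o s)"
  proof (rule antisymI)
    fix x y assume "(x, y) \<in> r \<oplus>\<^sub>o s" "(y, x) \<in> r \<oplus>\<^sub>o s"
    then show "x = y"
      by (cases x; cases y)
        (auto simp: mem_ordinal_sum dest: antisymD[OF r(3)] antisymD[OF s(3)])
  qed
  ultimately show ?thesis
    by (auto simp: partial_order_on_def preorder_on_def intro: FieldI1 FieldI2)
qed

lemma Field_power_order:
  assumes "Partial_order r"
  shows "Field (power_order r k) = {..<k} \<rightarrow>\<^sub>E Field r"
proof -
  have "\<And>x. x \<in> Field r \<Longrightarrow> (x, x) \<in> r"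
    using assms by (auto simp: partial_order_on_def preorder_on_def refl_on_def)
  then have "(x, x) \<in> power_order r k" if "x \<in> {..<k} \<rightarrow>\<^sub>E Field r" for x
    using that by (auto simp: power_order_def)
  then show ?thesis
    by (auto simp: power_order_def Field_def)
qed

end

theory Submission
  imports Defs
begin

text \<open>
  Let \<open>A\<close> and \<open>B\<close> be the lower and upper antichains. A surjective polymorphism \<open>f\<close> maps \<open>A\<^sup>k\<close> onto
  \<open>A\<close> and \<open>B\<^sup>k\<close> onto \<open>B\<close>. If two tuples \<open>z, z'\<close> of \<open>B\<^sup>k\<close> differ only at \<open>i\<close> and have different images,
  then every tuple below both of them has its image in \<open>A\<close>. Replacing \<open>z\<^sub>i\<close> by an element \<open>a\<close> of \<open>A\<close>
  gives such a tuple, and it lies above every \<open>u \<in> A\<^sup>k\<close> with \<open>u\<^sub>i = a\<close>; so \<open>f\<close> restricted to \<open>A\<^sup>k\<close>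
  depends on coordinate \<open>i\<close> only. Dually \<open>f\<close> restricted to \<open>B\<^sup>k\<close> depends on coordinate \<open>i\<close> only, and
  comparing a mixed tuple with tuples of \<open>A\<^sup>k\<close> below it and of \<open>B\<^sup>k\<close> above it finishes the proof.
\<close>

text \<open>Walk from \<open>x\<close> to \<open>y\<close> changing one coordinate at a time; some
  step must change the value of \<open>f\<close>.\<close>

lemma essential_coordinate_exists:
  fixes f :: "(nat \<Rightarrow> 'a) \<Rightarrow> 'b"
  assumes "x \<in> {..<k} \<rightarrow>\<^sub>E B" "y \<in> {..<k} \<rightarrow>\<^sub>E B" "f x \<noteq> f y"
  shows "\<exists>i<k. \<exists>z\<in>{..<k} \<rightarrow>\<^sub>E B. \<exists>b\<in>B. f (z(i := b)) \<noteq> f z"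
proof (rule ccontr)
  assume "\<not> ?thesis"
  then have const: "f (z(i := b)) = f z" if "i < k" "z \<in> {..<k} \<rightarrow>\<^sub>E B" "b \<in> B" for i z b
    using that by blast
  define w where "w j = (\<lambda>i. if i < j then y i else x i)" for j
  have "w j \<in> {..<k} \<rightarrow>\<^sub>E B \<and> f (w j) = f x" if "j \<le> k" for j
    using that
  proof (induction j)
    case 0
    then show ?case using assms(1) by (simp add: w_def)
  next
    case (Suc j)
    have step: "w (Suc j) = (w j)(j := y j)" by (auto simp: w_def)
    have j: "j < k" and y: "y j \<in> B" using assms(2) Suc.prems by (auto simp: PiE_iff)
    have w: "w j \<in> {..<k} \<rightarrow>\<^sub>E B" "f (w j) = f x" using Suc.IH j by auto
    have "(w j)(j := y j) \<in> {..<k} \<rightarrow>\<^sub>E B"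
      using w(1) y j by (auto simp: PiE_iff extensional_def)
    then show ?case using const[OF j w(1) y] w(2) by (simp only: step)
  qed
  moreover have "w k = y"
    \<comment> \<open>Beyond \<open>k\<close> the hybrid still follows \<open>x\<close>, but there
      \<open>x\<close> and \<open>y\<close> are both \<open>undefined\<close>.\<close>
    by (rule ext) (simp add: w_def PiE_arb[OF assms(1)] PiE_arb[OF assms(2)])
  ultimately show False using assms(3) by (metis order_refl)
qed

text \<open>
  The order on \<open>A \<union> B\<close> is written out as \<open>x = y \<or> x \<in> A \<and> y \<in> B\<close>, so that order duality amounts to
  exchanging \<open>A\<close> and \<open>B\<close>.
\<close>

locale two_level_polymorphism =
  fixes A B :: "'a set" and k :: nat and f :: "(nat \<Rightarrow> 'a) \<Rightarrow> 'a"
  assumes disjoint: "A \<inter> B = {}"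
    and two_A: "\<exists>a\<in>A. \<exists>a'\<in>A. a \<noteq> a'"
    and two_B: "\<exists>b\<in>B. \<exists>b'\<in>B. b \<noteq> b'"
    and surj: "f ` ({..<k} \<rightarrow>\<^sub>E A \<union> B) = A \<union> B"
    and mono: "\<And>x y. \<lbrakk>x \<in> {..<k} \<rightarrow>\<^sub>E A \<union> B; y \<in> {..<k} \<rightarrow>\<^sub>E A \<union> B;
        \<And>i. i < k \<Longrightarrow> x i = y i \<or> x i \<in> A \<and> y i \<in> B\<rbrakk> \<Longrightarrow> f x = f y \<or> f x \<in> A \<and> f y \<in> B"
begin

lemma dual: "two_level_polymorphism B A k f"
proof
  fix x y :: "nat \<Rightarrow> 'a"
  assume xy: "x \<in> {..<k} \<rightarrow>\<^sub>E B \<union> A" "y \<in> {..<k} \<rightarrow>\<^sub>E B \<union> A"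
    and le: "\<And>i. i < k \<Longrightarrow> x i = y i \<or> x i \<in> B \<and> y i \<in> A"
  note xy = xy[unfolded Un_commute[of B A]]
  have "f y = f x \<or> f y \<in> A \<and> f x \<in> B"
    by (rule mono[OF xy(2,1)]) (use le in fastforce)
  then show "f x = f y \<or> f x \<in> B \<and> f y \<in> A" by auto
next
  show "B \<inter> A = {}" using disjoint by blast
  show "f ` ({..<k} \<rightarrow>\<^sub>E B \<union> A) = B \<union> A" unfolding Un_commute[of B A] by (rule surj)
qed (rule two_B two_A)+

lemma lower_tuple_carrier: "u \<in> {..<k} \<rightarrow>\<^sub>E A \<Longrightarrow> u \<in> {..<k} \<rightarrow>\<^sub>E A \<union> B"
  by (auto simp: PiE_iff)

lemma upper_tuple_carrier: "z \<in> {..<k} \<rightarrow>\<^sub>E B \<Longrightarrow> z \<in> {..<k} \<rightarrow>\<^sub>E A \<union> B"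
  by (auto simp: PiE_iff)

text \<open>Elements of \<open>A\<close> are minimal.\<close>

lemma eq_of_below_lower:
  assumes "x \<in> {..<k} \<rightarrow>\<^sub>E A \<union> B" "y \<in> {..<k} \<rightarrow>\<^sub>E A \<union> B"
    "\<And>i. i < k \<Longrightarrow> x i = y i \<or> x i \<in> A \<and> y i \<in> B" "f y \<in> A"
  shows "f x = f y"
  using mono[OF assms(1-3)] assms(4) disjoint by blast

text \<open>Elements of \<open>B\<close> are maximal, so none lies below two distinct
  elements.\<close>

lemma lower_of_below_two:
  assumes "x \<in> {..<k} \<rightarrow>\<^sub>E A \<union> B" "y \<in> {..<k} \<rightarrow>\<^sub>E A \<union> B" "z \<in> {..<k} \<rightarrow>\<^sub>E A \<union> B"
    "\<And>i. i < k \<Longrightarrow> x i = y i \<or> x i \<in> A \<and> y i \<in> B"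
    "\<And>i. i < k \<Longrightarrow> x i = z i \<or> x i \<in> A \<and> z i \<in> B" "f y \<noteq> f z"
  shows "f x \<in> A"
  using mono[OF assms(1,2,4)] mono[OF assms(1,3,5)] assms(6) by auto

lemma surj_lower:
  assumes "a \<in> A"
  obtains u where "u \<in> {..<k} \<rightarrow>\<^sub>E A" "f u = a"
proof -
  obtain x where x: "x \<in> {..<k} \<rightarrow>\<^sub>E A \<union> B" "f x = a" using surj assms by (metis UnI1 imageE)
  \<comment> \<open>Pushing the upper entries of a preimage \<open>x\<close> down to
    \<open>a\<close> gives a tuple below \<open>x\<close>, and the value \<open>a\<close> is
    minimal.\<close>
  define u where "u = (\<lambda>i\<in>{..<k}. if x i \<in> A then x i else a)"
  have u: "u \<in> {..<k} \<rightarrow>\<^sub>E A" using assms by (auto simp: u_def)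
  have "f u = f x"
    by (rule eq_of_below_lower[OF lower_tuple_carrier[OF u] x(1)])
      (use x assms in \<open>auto simp: u_def PiE_iff\<close>)
  then show thesis using that u x by simp
qed

lemma lower_depends_on_essential_upper:
  assumes i: "i < k" and z: "z \<in> {..<k} \<rightarrow>\<^sub>E B" and b: "b \<in> B" and ne: "f (z(i := b)) \<noteq> f z"
    and u: "u \<in> {..<k} \<rightarrow>\<^sub>E A" and v: "v \<in> {..<k} \<rightarrow>\<^sub>E A" and eq: "u i = v i"
  shows "f u = f v"
proof -
  define x where "x = z(i := u i)"
  have ui: "u i \<in> A" using u i by auto
  have zb: "z(i := b) \<in> {..<k} \<rightarrow>\<^sub>E A \<union> B" and x: "x \<in> {..<k} \<rightarrow>\<^sub>E A \<union> B"
    using z b i ui by (auto simp: PiE_iff extensional_def x_def)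
  have zi: "z j \<in> B" if "j < k" for j using z that by auto
  have "f x \<in> A"
    by (rule lower_of_below_two[OF x zb upper_tuple_carrier[OF z] _ _ ne])
      (use ui b zi in \<open>auto simp: x_def\<close>)
  moreover have "w j = x j \<or> w j \<in> A \<and> x j \<in> B" if "w \<in> {..<k} \<rightarrow>\<^sub>E A" "w i = u i" "j < k" for w j
    using that zi[of j] by (auto simp: x_def PiE_iff)
  ultimately have "f w = f x" if "w \<in> {..<k} \<rightarrow>\<^sub>E A" "w i = u i" for w
    using that eq_of_below_lower[OF lower_tuple_carrier[OF that(1)] x] by blast
  then show ?thesis using u v eq by metis
qed

text \<open>By the dual of \<open>surj_lower\<close>, \<open>f\<close> takes two different values on
  tuples over \<open>B\<close>.\<close>

lemma essential_upper_exists: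
  obtains i z b where "i < k" "z \<in> {..<k} \<rightarrow>\<^sub>E B" "b \<in> B" "f (z(i := b)) \<noteq> f z"
proof -
  interpret dual: two_level_polymorphism B A k f by (rule dual)
  obtain b b' where "b \<in> B" "b' \<in> B" "b \<noteq> b'" using two_B by blast
  then obtain x y where "x \<in> {..<k} \<rightarrow>\<^sub>E B" "y \<in> {..<k} \<rightarrow>\<^sub>E B" "f x \<noteq> f y"
    using dual.surj_lower by metis
  then show thesis using essential_coordinate_exists[of x k B y f] that by blast
qed

text \<open>\<open>upper\<close> is a hypothesis because it comes from an essential coordinate of
  the lower tuples, which must first be shown to be the same \<open>i\<close>.\<close>

lemma eq_diagonal_of_lower_coordinate:
  assumes i: "i < k" and z: "z \<in> {..<k} \<rightarrow>\<^sub>E B" and b: "b \<in> B" and ne: "f (z(i := b)) \<noteq> f z"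
    and upper: "\<And>y y'. \<lbrakk>y \<in> {..<k} \<rightarrow>\<^sub>E B; y' \<in> {..<k} \<rightarrow>\<^sub>E B; y i = y' i\<rbrakk> \<Longrightarrow> f y = f y'"
    and x: "x \<in> {..<k} \<rightarrow>\<^sub>E A \<union> B" and xi: "x i \<in> A"
  shows "f x = f (\<lambda>j\<in>{..<k}. x i)"
proof -
  \<comment> \<open>For every \<open>c\<close> in \<open>B\<close>, \<open>y c\<close> is an upper
    tuple above \<open>x\<close> with entry \<open>c\<close> at \<open>i\<close>; \<open>b\<close>
    is mere filler. By \<open>upper\<close>, the choices \<open>b\<close> and \<open>z i\<close>
    reproduce the two distinct values in \<open>ne\<close>.\<close>
  define y where "y c = (\<lambda>j\<in>{..<k}. if j = i then c else if x j \<in> B then x j else b)" for c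
  have y: "y c \<in> {..<k} \<rightarrow>\<^sub>E B" if "c \<in> B" for c using that b by (auto simp: y_def)
  have yi: "y c i = c" for c using i by (simp add: y_def)
  have zi: "z i \<in> B" using z i by auto
  have zb: "z(i := b) \<in> {..<k} \<rightarrow>\<^sub>E B" using z b i by (auto simp: PiE_iff extensional_def)
  have "f (y b) = f (z(i := b))" by (rule upper) (use y b yi zb in auto)
  moreover have "f (y (z i)) = f z" by (rule upper) (use y zi yi z in auto)
  ultimately have ne': "f (y b) \<noteq> f (y (z i))" using ne by simp
  have le: "x j = y c j \<or> x j \<in> A \<and> y c j \<in> B" if "c \<in> B" "j < k" for c j
    using that x xi b by (auto simp: y_def PiE_iff)
  have fx: "f x \<in> A"
    by (rule lower_of_below_two[OF x upper_tuple_carrier upper_tuple_carrier _ _ ne'])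
      (use y b zi le in auto)
  \<comment> \<open>A lower tuple below \<open>x\<close> with the same entry at \<open>i\<close>: it
    links \<open>x\<close> to the diagonal tuple.\<close>
  define u where "u = (\<lambda>j\<in>{..<k}. if x j \<in> A then x j else x i)"
  have u: "u \<in> {..<k} \<rightarrow>\<^sub>E A" using xi by (auto simp: u_def)
  have "f u = f x"
    by (rule eq_of_below_lower[OF lower_tuple_carrier[OF u] x _ fx])
      (use x xi in \<open>auto simp: u_def PiE_iff\<close>)
  moreover have "f u = f (\<lambda>j\<in>{..<k}. x i)"
    by (rule lower_depends_on_essential_upper[OF i z b ne u]) (use xi i in \<open>auto simp: u_def\<close>)
  ultimately show ?thesis by simp
qed

theorem eq_diagonal: "\<exists>i<k. \<forall>x \<in> {..<k} \<rightarrow>\<^sub>E A \<union> B. f x = f (\<lambda>j\<in>{..<k}. x i)"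
proof -
  interpret dual: two_level_polymorphism B A k f by (rule dual)
  obtain i z b where z: "i < k" "z \<in> {..<k} \<rightarrow>\<^sub>E B" "b \<in> B" "f (z(i := b)) \<noteq> f z"
    by (rule essential_upper_exists)
  note lower = lower_depends_on_essential_upper[OF z]
  obtain i' u a where u: "i' < k" "u \<in> {..<k} \<rightarrow>\<^sub>E A" "a \<in> A" "f (u(i' := a)) \<noteq> f u"
    by (rule dual.essential_upper_exists)
  have "u(i' := a) \<in> {..<k} \<rightarrow>\<^sub>E A" using u by (auto simp: PiE_iff extensional_def)
  \<comment> \<open>If \<open>i'\<close> differed from \<open>i\<close>, then \<open>u\<close> and
    \<open>u(i' := a)\<close> would agree at \<open>i\<close>, and \<open>lower\<close> would equate
    their values.\<close>
  from lower[OF this u(2)] u(4) have "i' = i" by (cases "i' = i") auto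
  note u = u[unfolded this]
  note upper = dual.lower_depends_on_essential_upper[OF u]
  show ?thesis
  proof (intro exI[of _ i] conjI ballI, rule z(1))
    fix x assume x: "x \<in> {..<k} \<rightarrow>\<^sub>E A \<union> B"
    then have x': "x \<in> {..<k} \<rightarrow>\<^sub>E B \<union> A" by (simp add: Un_commute)
    have "x i \<in> A \<or> x i \<in> B" using x z(1) by auto
    then show "f x = f (\<lambda>j\<in>{..<k}. x i)"
      using eq_diagonal_of_lower_coordinate[OF z upper x]
        dual.eq_diagonal_of_lower_coordinate[OF u lower x']
      by blast
  qed
qed

end

text \<open>Restricting \<open>f\<close> to the diagonal supplies the unary map \<open>g\<close> of
  \<open>essentially_unary\<close>.\<close>

lemma monotone_map_diagonal:
  assumes "Partial_order r" "polymorphism r k f"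
  shows "monotone_map r r (\<lambda>p. f (\<lambda>j\<in>{..<k}. p))"
proof -
  have diag: "(\<lambda>j\<in>{..<k}. p) \<in> Field (power_order r k)" if "p \<in> Field r" for p
    using that by (auto simp: Field_power_order[OF assms(1)])
  have "((\<lambda>j\<in>{..<k}. p), (\<lambda>j\<in>{..<k}. q)) \<in> power_order r k" if "(p, q) \<in> r" for p q
    using that by (auto simp: power_order_def intro: FieldI1 FieldI2)
  with diag assms(2) show ?thesis
    unfolding polymorphism_def monotone_map_def monotone_on_def by blast
qed

lemma ordinal_sum_antichains:
  "antichain m \<oplus>\<^sub>o antichain n =
     Id_on (Inl ` {..<m} \<union> Inr ` {..<n}) \<union> Inl ` {..<m} \<times> Inr ` {..<n}"
  by (auto simp: ordinal_sum_def antichain_def Field_def)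

theorem theorem5p1:
  fixes m n :: nat
  assumes "m \<ge> 2" and "n \<ge> 2"
  shows "slupecki (antichain m \<oplus>\<^sub>o antichain n)"
  unfolding slupecki_def
proof (intro allI impI, elim conjE)
  let ?r = "antichain m \<oplus>\<^sub>o antichain n"
  let ?A = "Inl ` {..<m} :: (nat + nat) set" and ?B = "Inr ` {..<n} :: (nat + nat) set"
  fix k :: nat and f
  assume poly: "polymorphism ?r k f" and surj: "f ` Field (power_order ?r k) = Field ?r"
  have po: "Partial_order ?r"
    by (intro Partial_order_ordinal_sum Partial_order_antichain)
  have Fr: "Field ?r = ?A \<union> ?B" by (simp add: Field_ordinal_sum)
  have Fp: "Field (power_order ?r k) = {..<k} \<rightarrow>\<^sub>E ?A \<union> ?B"
    by (simp only: Field_power_order[OF po] Fr)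
  have le: "(p, q) \<in> ?r \<longleftrightarrow> p \<in> ?A \<union> ?B \<and> p = q \<or> p \<in> ?A \<and> q \<in> ?B" for p q
    by (auto simp: ordinal_sum_antichains)
  interpret two_level_polymorphism ?A ?B k f
  proof
    show "\<exists>a\<in>?A. \<exists>a'\<in>?A. a \<noteq> a'" 
      using assms(1) by (intro bexI[of _ "Inl 0"] bexI[of _ "Inl 1"]) auto
    show "\<exists>b\<in>?B. \<exists>b'\<in>?B. b \<noteq> b'" 
      using assms(2) by (intro bexI[of _ "Inr 0"] bexI[of _ "Inr 1"]) auto
    show "f ` ({..<k} \<rightarrow>\<^sub>E ?A \<union> ?B) = ?A \<union> ?B" using surj by (simp only: Fr Fp)
  next
    fix x y
    assume xy: "x \<in> {..<k} \<rightarrow>\<^sub>E ?A \<union> ?B" "y \<in> {..<k} \<rightarrow>\<^sub>E ?A \<union> ?B"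
      and "\<And>i. i < k \<Longrightarrow> x i = y i \<or> x i \<in> ?A \<and> y i \<in> ?B"
    then have "(x i, y i) \<in> ?r" if "i < k" for i
      using that unfolding le by (meson PiE_mem lessThan_iff)
    then have "(x, y) \<in> power_order ?r k"
      using xy by (simp add: power_order_def Fr)
    then have "(f x, f y) \<in> ?r"
      using poly xy unfolding polymorphism_def monotone_map_def monotone_on_def Fp by blast
    then show "f x = f y \<or> f x \<in> ?A \<and> f y \<in> ?B" unfolding le by blast
  qed auto
  show "essentially_unary ?r k f"
    unfolding essentially_unary_def Fp using eq_diagonal monotone_map_diagonal[OF po poly] by blast
qed

end
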